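(* Let $T$ be a singular integral operator with kernel $K$, that is, $T$ maps $L^\infty_c$ to measurable functions on $\mathbb{R}^n$ and $$Tf(x)=\int_{\mathbb{R}^n}K(x,y)\,f(y)\,dy,\qquad x\notin\operatorname{supp}f,\quad f\in L^\infty_c,$$ where $K$ is a measurable function defined away from the diagonal $\{(x,y)\in\mathbb{R}^n\times\mathbb{R}^n: x=y\}$. (i) If there is a constant $C$ such that $K$ satisfies the Hörmander condition $$\int_{|x-y|>2|y-y'|}|K(x,y)-K(x,y')|\,dx\le C\qquad\text{for all }y,y'\in\mathbb{R}^n,$$ then there is a constant $C'$ such that, for every ball $B\subset\mathbb{R}^n$ and every bounded function $f$ supported on $B$ with mean $0$ (that is, $\int_B f\,dx=0$), $$\int_{\mathbb{R}^n\setminus 4B}|Tf(x)|\,dx\le C'\int_B|f(x)|\,dx.$$ (ii) If there are constants $C$ and $\gamma>0$ such that $K$ satisfies the Hölder condition $$|K(x,y)-K(x',y)|\le C\,\frac{|x-x'|^\gamma}{|x-y|^{n+\gamma}}\qquad\text{whenever }|x-y|>2|x-x'|,$$ then there is a constant $C'$ such that, for every ball $B\subset\mathbb{R}^n$ and every bounded compactly supported function $f$ supported on $\mathbb{R}^n\setminus 4B$, $$\sup_{x\in B}|Tf(x)|\le \frac{C'}{|2B|}\int_{2B}|Tf(x)|\,dx+C'\inf_{x\in B}Mf(x).$$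
   Context: $L^\infty_c$ denotes the space of bounded (complex-valued) functions on $\mathbb{R}^n$ with compact support; $dx$ (or $|\cdot|$ for sets) is Lebesgue measure. It is part of the representation formula for $Tf$ that the integral converges absolutely for $x\notin\operatorname{supp} f$. For a ball $B$ with radius $r(B)$ and $\lambda>0$, $\lambda B$ is the concentric ball with radius $\lambda r(B)$. $M$ is the Hardy-Littlewood maximal operator, $Mf(x)=\sup_{B\ni x}\frac1{|B|}\int_B|f(y)|\,dy$, the supremum being over all balls containing $x$. *)

theory Defs
  imports "HOL-Analysis.Analysis"
begin

definition fun_supp :: "(real^'n \<Rightarrow> complex) \<Rightarrow> (real^'n) set" where
  "fun_supp f = closure {x. f x \<noteq> 0}"

text \<open>The elements are functions, not almost-everywhere classes: pointwise values of
  \<open>T f\<close> off the support matter below. Measurability is with respect to Lebesgue (not Borel) sets.\<close>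

definition Linf_c :: "(real^'n \<Rightarrow> complex) set" where
  "Linf_c = {f. f \<in> borel_measurable lebesgue \<and> bounded (range f) \<and> compact (fun_supp f)}"

text \<open>The kernel is a total function in HOL, but it is only assumed measurable off the diagonal
  and its values on the diagonal enter none of the conditions below. The operator \<open>T\<close>
  is constrained only on \<open>Linf_c\<close>; linearity is not part of the definition.\<close>

definition singular_integral_operator ::
  "((real^'n \<Rightarrow> complex) \<Rightarrow> (real^'n \<Rightarrow> complex)) \<Rightarrow> (real^'n \<Rightarrow> real^'n \<Rightarrow> complex) \<Rightarrow> bool" where
  "singular_integral_operator T K \<longleftrightarrow>
     (\<lambda>(x, y). K x y) \<in> borel_measurable (lebesgue_on {(x, y). x \<noteq> y}) \<and>
     (\<forall>f\<in>Linf_c. T f \<in> borel_measurable lebesgue) \<and>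
     (\<forall>f\<in>Linf_c. \<forall>x. x \<notin> fun_supp f \<longrightarrow>
        integrable lebesgue (\<lambda>y. K x y * f y) \<and>
        T f x = (\<integral>y. K x y * f y \<partial>lebesgue))"

text \<open>Joint Lebesgue measurability of \<open>K\<close> makes the slices \<open>K (_, y)\<close> measurable
  for almost every \<open>y\<close> only. At exceptional points the nonnegative integral is the lower
  integral, so no measurability of individual slices is being assumed.\<close>

definition hormander_condition :: "(real^'n \<Rightarrow> real^'n \<Rightarrow> complex) \<Rightarrow> real \<Rightarrow> bool" where
  "hormander_condition K C \<longleftrightarrow>
     (\<forall>y y'. (\<integral>\<^sup>+x\<in>{x. norm (x - y) > 2 * norm (y - y')}.
                ennreal (norm (K x y - K x y')) \<partial>lebesgue) \<le> ennreal C)"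

definition holder_condition :: "(real^'n \<Rightarrow> real^'n \<Rightarrow> complex) \<Rightarrow> real \<Rightarrow> real \<Rightarrow> bool" where
  "holder_condition K C \<gamma> \<longleftrightarrow>
     (\<forall>x x' y. norm (x - y) > 2 * norm (x - x') \<longrightarrow>
        norm (K x y - K x' y) \<le>
          C * (norm (x - x') powr \<gamma> / norm (x - y) powr (real CARD('n) + \<gamma>)))"

definition hl_maximal :: "(real^'n \<Rightarrow> complex) \<Rightarrow> real^'n \<Rightarrow> ennreal" where
  "hl_maximal f x =
     (SUP (c, r) \<in> {(c, r). 0 < r \<and> x \<in> ball c r}.
        (\<integral>\<^sup>+y\<in>ball c r. ennreal (norm (f y)) \<partial>lebesgue) / emeasure lebesgue (ball c r))"

end

theory Submission
  imports Defs
begin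

text \<open>Write B for \<open>ball c r\<close>. In (i), a point x outside 4B is off the support of
  f, and since f has mean zero, T f x is the integral of (K x y - K x c') * f y for any fixed c'
  near the centre. Take norms, integrate over the complement of 4B, exchange the integrals by
  Tonelli, and bound the inner integral over x by the Hormander condition for y and c'. This is
  \<open>hormander_mean_zero_bound\<close>. The delicate point is measurability: K is only jointly
  Lebesgue measurable, so Tonelli is applied to a Borel function k equal to K almost everywhere
  (\<open>kernel_borel_version\<close>), and c' is chosen among the points whose slice agrees with
  that of k.

  In (ii), let x be in B and x' within r of x. Both are off the support of f, so T f x - T f x' is
  the integral of (K x y - K x' y) * f y. By the Hoelder condition this is at most a constant times
  the integral of |f| against r^\<gamma> / |x - y|^(n + \<gamma>) away from x. Summing over dyadic
  annuli bounds that by the maximal function at any z in B (\<open>hl_maximal_tail_bound\<close>,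
  \<open>holder_oscillation_bound\<close>). Averaging over x' in \<open>ball x r\<close>, a subset
  of 2B, turns |T f x'| into the mean over 2B (\<open>holder_sup_bound\<close>), and z is free, so
  the infimum over B may be taken.\<close>

section \<open>Borel representatives of Lebesgue measurable kernels\<close>

lemma completion_ex_borel_measurable_complex:
  fixes f :: "'a \<Rightarrow> complex"
  assumes f: "f \<in> borel_measurable (completion M)"
  shows "\<exists>g\<in>borel_measurable M. AE x in M. f x = g x"
proof -
  have "(\<lambda>x. Re (f x)) \<in> borel_measurable (completion M)"
    "(\<lambda>x. Im (f x)) \<in> borel_measurable (completion M)"
    using f by auto
  then obtain u v where uv: "u \<in> borel_measurable M" "v \<in> borel_measurable M"
    and ae: "AE x in M. Re (f x) = u x" "AE x in M. Im (f x) = v x"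
    using completion_ex_borel_measurable_real[of _ M] by meson
  let ?g = "\<lambda>x. complex_of_real (u x) + \<i> * complex_of_real (v x)"
  show ?thesis
  proof (rule bexI[of _ ?g])
    show "AE x in M. f x = ?g x"
      using ae by eventually_elim (simp add: complex_eq_iff)
    show "?g \<in> borel_measurable M"
      using uv by measurable
  qed
qed

lemma off_diagonal_sets_lebesgue:
  "{(x, y). x \<noteq> y} \<in> sets (lebesgue :: (('a::euclidean_space) \<times> 'a) measure)"
proof -
  have "open {p :: 'a \<times> 'a. fst p \<noteq> snd p}"
    by (intro open_Collect_neq continuous_intros)
  moreover have "{(x, y). x \<noteq> y} = {p :: 'a \<times> 'a. fst p \<noteq> snd p}"
    by auto
  ultimately show ?thesis
    by simp
qed

text \<open>Lebesgue measure on the product space completes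
  \<open>lborel \<Otimes>\<^sub>M lborel\<close>, so a Lebesgue measurable kernel differs from a
  Borel one on a null set, almost all of whose slices in either direction are null. All slices of k
  are measurable, and Tonelli applies to it.\<close>

lemma kernel_borel_version:
  fixes K :: "'a::euclidean_space \<Rightarrow> 'a \<Rightarrow> complex"
  assumes "(\<lambda>(x, y). K x y) \<in> borel_measurable (lebesgue_on {(x, y). x \<noteq> y})"
  obtains k where "k \<in> borel_measurable (lborel \<Otimes>\<^sub>M lborel)"
    "AE x in lborel. AE y in lborel. x \<noteq> y \<longrightarrow> K x y = k (x, y)"
    "AE y in lborel. AE x in lborel. x \<noteq> y \<longrightarrow> K x y = k (x, y)"
proof -
  \<comment> \<open>Extension by 0 across the diagonal, where nothing is known about K.\<close>
  let ?K = "\<lambda>p :: 'a \<times> 'a. if p \<in> {(x, y). x \<noteq> y} then (case p of (x, y) \<Rightarrow> K x y) else 0"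
  have "?K \<in> borel_measurable lebesgue"
    using assms off_diagonal_sets_lebesgue by (subst borel_measurable_if) auto
  from completion_ex_borel_measurable_complex[OF this]
  obtain k where k: "k \<in> borel_measurable lborel" "AE p in lborel. ?K p = k p"
    by blast
  have ae: "AE p in lborel \<Otimes>\<^sub>M lborel. ?K p = k p"
    unfolding lborel_prod using k(2) .
  \<comment> \<open>The product measure is invariant under swapping coordinates, which yields the
    slices at fixed y.\<close>
  have "AE p in lborel \<Otimes>\<^sub>M lborel. case p of (y, x) \<Rightarrow> ?K (x, y) = k (x, y)"
  proof -
    have "AE p in distr (lborel \<Otimes>\<^sub>M lborel) (lborel \<Otimes>\<^sub>M lborel) (\<lambda>(x, y). (y, x)). ?K p = k p"
      by (subst lborel_pair.distr_pair_swap[symmetric]) (rule ae)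
    from AE_distrD[OF measurable_pair_swap' this] show ?thesis
      by (simp only: case_prod_unfold)
  qed
  then have 1: "AE y in lborel. AE x in lborel. ?K (x, y) = k (x, y)"
    using lborel_pair.AE_pair[of "\<lambda>p. case p of (y, x) \<Rightarrow> ?K (x, y) = k (x, y)"]
    by (simp only: prod.case)
  have 2: "AE x in lborel. AE y in lborel. ?K (x, y) = k (x, y)"
    using lborel_pair.AE_pair[OF ae] .
  show thesis
  proof
    show "k \<in> borel_measurable (lborel \<Otimes>\<^sub>M lborel)"
      using k(1) by (simp add: lborel_prod)
    show "AE x in lborel. AE y in lborel. x \<noteq> y \<longrightarrow> K x y = k (x, y)"
      by (rule eventually_mono[OF 2], erule eventually_mono, rule impI) simp
    show "AE y in lborel. AE x in lborel. x \<noteq> y \<longrightarrow> K x y = k (x, y)"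
      by (rule eventually_mono[OF 1], erule eventually_mono, rule impI) simp
  qed
qed

text \<open>Balls are not null. This supplies a good slice of the kernel arbitrarily close to the
  centre.\<close>

lemma AE_lborel_ex_in_ball:
  fixes c :: "'a::euclidean_space"
  assumes "AE x in lborel. P x" "0 < r"
  shows "\<exists>x\<in>ball c r. P x"
proof (rule ccontr)
  assume "\<not> ?thesis"
  then have "P x \<Longrightarrow> x \<notin> ball c r" for x
    by blast
  with assms(1) have "AE x in lborel. x \<notin> ball c r"
    by (rule eventually_mono)
  then have "negligible (ball c r)"
    using AE_iff_null_sets[of "ball c r" lborel]
    by (simp add: negligible_iff_null_sets null_sets_completion_iff del: mem_ball)
  then show False
    using \<open>0 < r\<close> by (simp add: open_not_negligible)
qed

section \<open>The representation formula and the Hormander estimate\<close>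

lemma integrable_lebesgue_of_ball_support:
  fixes f :: "real^'n \<Rightarrow> complex"
  assumes f: "f \<in> Linf_c" and supp: "\<forall>x. x \<notin> ball c r \<longrightarrow> f x = 0"
  shows "integrable lebesgue f"
proof -
  obtain B where "\<And>x. norm (f x) \<le> B"
    using f by (auto simp: Linf_c_def bounded_iff)
  with f supp show ?thesis
    by (intro integrableI_bounded_set[where A = "ball c r" and B = B])
      (auto simp: Linf_c_def emeasure_lborel_ball_finite[simplified])
qed

lemma singular_integral_operator_eq:
  assumes "singular_integral_operator T K" "f \<in> Linf_c" "x \<notin> fun_supp f"
  shows "integrable lebesgue (\<lambda>y. K x y * f y)" "T f x = (\<integral>y. K x y * f y \<partial>lebesgue)"
proof -
  have "\<forall>f\<in>Linf_c. \<forall>x. x \<notin> fun_supp f \<longrightarrow>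
    integrable lebesgue (\<lambda>y. K x y * f y) \<and> T f x = (\<integral>y. K x y * f y \<partial>lebesgue)"
    using assms(1) unfolding singular_integral_operator_def by (elim conjE)
  from this[rule_format, OF assms(2,3)]
  show "integrable lebesgue (\<lambda>y. K x y * f y)" "T f x = (\<integral>y. K x y * f y \<partial>lebesgue)"
    by (rule conjunct1, rule conjunct2)
qed

lemma fun_supp_subset_closed:
  assumes "closed S" "\<And>x. f x \<noteq> 0 \<Longrightarrow> x \<in> S"
  shows "fun_supp f \<subseteq> S"
proof -
  have "{x. f x \<noteq> 0} \<subseteq> S"
    using assms(2) by blast
  then show ?thesis
    unfolding fun_supp_def using assms(1) by (rule closure_minimal)
qed

text \<open>The mean-zero condition allows any constant in \<open>y\<close> to be subtracted from the kernel. The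
  constant is \<open>K x c'\<close> with \<open>c'\<close> only near the centre, since the slice at the centre itself
  may fail to be measurable.\<close>

lemma hormander_mean_zero_bound:
  fixes T :: "(real^'n \<Rightarrow> complex) \<Rightarrow> (real^'n \<Rightarrow> complex)"
  assumes T: "singular_integral_operator T K" and C: "hormander_condition K C"
    and r: "0 < r" and f: "f \<in> Linf_c" and supp: "\<forall>x. x \<notin> ball c r \<longrightarrow> f x = 0"
    and mean: "(LINT x:ball c r|lebesgue. f x) = 0"
  shows "(\<integral>\<^sup>+x\<in>- ball c (4 * r). ennreal (norm (T f x)) \<partial>lebesgue)
    \<le> ennreal C * (\<integral>\<^sup>+x\<in>ball c r. ennreal (norm (f x)) \<partial>lebesgue)"
proof -
  obtain k where k [measurable]: "k \<in> borel_measurable (lborel \<Otimes>\<^sub>M lborel)"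
    and k1: "AE x in lborel. AE y in lborel. x \<noteq> y \<longrightarrow> K x y = k (x, y)"
    and k2: "AE y in lborel. AE x in lborel. x \<noteq> y \<longrightarrow> K x y = k (x, y)"
    using T unfolding singular_integral_operator_def by (elim conjE kernel_borel_version)
  \<comment> \<open>Radius r/2 is small enough for the Hormander condition: if x is outside 4B and y
    in B, then |x - y| > 3r, while 2|y - c'| < 3r.\<close>
  obtain c' where c': "c' \<in> ball c (r / 2)"
    and kc: "AE x in lborel. x \<noteq> c' \<longrightarrow> K x c' = k (x, c')"
    using AE_lborel_ex_in_ball[OF k2, of "r / 2" c] r by auto
  have f_meas: "f \<in> borel_measurable lebesgue"
    using f by (simp add: Linf_c_def)
  obtain g where g [measurable]: "g \<in> borel_measurable lborel" and fg: "AE x in lborel. f x = g x"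
    using completion_ex_borel_measurable_complex[OF f_meas] by blast
  have f_int: "integrable lebesgue f"
    using integrable_lebesgue_of_ball_support[OF f supp] .
  have f_zero: "(\<integral>x. f x \<partial>lebesgue) = 0"
  proof -
    have "(\<lambda>x. indicat_real (ball c r) x *\<^sub>R f x) = f"
      using supp by (auto simp: indicator_def)
    with mean show ?thesis
      by (simp add: set_lebesgue_integral_def)
  qed
  have supp': "fun_supp f \<subseteq> cball c r"
    using supp by (intro fun_supp_subset_closed) (auto simp: less_imp_le intro: ccontr)
  let ?D = "- ball c (4 * r)"
  have far: "x \<notin> fun_supp f" "x \<noteq> c'" if "x \<in> ?D" for x
  proof -
    have "dist c x \<ge> 4 * r" "dist c c' < r / 2"
      using that c' by auto
    then show "x \<notin> fun_supp f" "x \<noteq> c'"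
      using supp' r by auto
  qed
  have sep: "norm (x - y) > 2 * norm (y - c')" if "x \<in> ?D" "y \<in> ball c r" for x y
  proof -
    have "dist c x \<ge> 4 * r" "dist c c' < r / 2" "dist c y < r"
      using that c' by auto
    moreover have "dist c x \<le> dist c y + dist x y" "dist y c' \<le> dist c y + dist c c'"
      using dist_triangle[of c x y] dist_triangle[of y c' c] by (simp_all add: dist_commute)
    ultimately show ?thesis
      unfolding dist_norm[symmetric] by linarith
  qed
  have [measurable]: "?D \<in> sets borel" "ball c r \<in> sets borel"
    by auto
  let ?h = "\<lambda>x y. ennreal (norm (k (x, y) - k (x, c'))) * indicator ?D x"
  let ?w = "\<lambda>y. ennreal (norm (g y)) * indicator (ball c r) y"
  \<comment> \<open>Completing a measure does not change nonnegative integrals, whatever the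
    integrand, so the work moves to \<open>lborel\<close>.\<close>
  have "(\<integral>\<^sup>+x\<in>?D. ennreal (norm (T f x)) \<partial>lebesgue) = (\<integral>\<^sup>+x\<in>?D. ennreal (norm (T f x)) \<partial>lborel)"
    by (rule nn_integral_completion)
  also have "\<dots> \<le> (\<integral>\<^sup>+x. \<integral>\<^sup>+y. ?h x y * ?w y \<partial>lborel \<partial>lborel)"
  proof (rule nn_integral_mono_AE)
    show "AE x in lborel. ennreal (norm (T f x)) * indicator ?D x \<le> (\<integral>\<^sup>+y. ?h x y * ?w y \<partial>lborel)"
      using k1 kc
    proof eventually_elim
      case (elim x)
      show ?case
      proof (cases "x \<in> ?D")
        case True
        note rep = singular_integral_operator_eq[OF T f far(1)[OF True]]
        \<comment> \<open>The subtracted integral is K x c' times the integral of f, hence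
          0.\<close>
        have "T f x = (\<integral>y. K x y * f y \<partial>lebesgue) - (\<integral>y. K x c' * f y \<partial>lebesgue)"
          using f_zero by (simp add: rep(2))
        also have "\<dots> = (\<integral>y. K x y * f y - K x c' * f y \<partial>lebesgue)"
          using rep(1) f_int by (intro Bochner_Integration.integral_diff[symmetric]) auto
        finally have Tf: "T f x = (\<integral>y. K x y * f y - K x c' * f y \<partial>lebesgue)" .
        have "ennreal (norm (T f x)) \<le> (\<integral>\<^sup>+y. norm (K x y * f y - K x c' * f y) \<partial>lebesgue)"
          unfolding Tf using rep(1) f_int
          by (intro integral_norm_bound_ennreal Bochner_Integration.integrable_diff) auto
        also have "\<dots> = (\<integral>\<^sup>+y. norm (K x y * f y - K x c' * f y) \<partial>lborel)"
          by (rule nn_integral_completion)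
        also have "\<dots> = (\<integral>\<^sup>+y. ?h x y * ?w y \<partial>lborel)"
        proof (rule nn_integral_cong_AE)
          show "AE y in lborel. ennreal (norm (K x y * f y - K x c' * f y)) = ?h x y * ?w y"
            using elim(1) fg
          proof eventually_elim
            case (elim y)
            show ?case
            proof (cases "y \<in> ball c r")
              case inside: True
              then have "x \<noteq> y"
                using True r by auto
              then show ?thesis
                using elim \<open>x \<noteq> c' \<longrightarrow> K x c' = k (x, c')\<close> far(2)[OF True] True inside
                by (simp add: left_diff_distrib[symmetric] norm_mult ennreal_mult)
            next
              case False
              then show ?thesis
                using supp by simp
            qed
          qed
        qed
        finally show ?thesis
          using True by simp
      qed simp
    qed
  qed
  also have "\<dots> = (\<integral>\<^sup>+y. \<integral>\<^sup>+x. ?h x y * ?w y \<partial>lborel \<partial>lborel)"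
  proof -
    have "(\<lambda>(x, y). ?h x y * ?w y) \<in> borel_measurable (lborel \<Otimes>\<^sub>M lborel)"
      by measurable
    from lborel_pair.Fubini[OF this] show ?thesis
      by simp
  qed
  also have "\<dots> = (\<integral>\<^sup>+y. (\<integral>\<^sup>+x. ?h x y \<partial>lborel) * ?w y \<partial>lborel)"
    by (intro nn_integral_cong nn_integral_multc) measurable
  also have "\<dots> \<le> (\<integral>\<^sup>+y. ennreal C * ?w y \<partial>lborel)"
  proof (rule nn_integral_mono_AE)
    show "AE y in lborel. (\<integral>\<^sup>+x. ?h x y \<partial>lborel) * ?w y \<le> ennreal C * ?w y"
      using k2
    proof eventually_elim
      case (elim y)
      show ?case
      proof (cases "y \<in> ball c r")
        case True
        let ?A = "{x. norm (x - y) > 2 * norm (y - c')}"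
        \<comment> \<open>Return from k to K, which the Hormander condition is about; this is
          possible because the slices at y and at c' both agree almost everywhere.\<close>
        have "(\<integral>\<^sup>+x. ?h x y \<partial>lborel) \<le> (\<integral>\<^sup>+x\<in>?A. ennreal (norm (K x y - K x c')) \<partial>lborel)"
        proof (rule nn_integral_mono_AE)
          show "AE x in lborel. ?h x y \<le> ennreal (norm (K x y - K x c')) * indicator ?A x"
            using elim kc
          proof eventually_elim
            case (elim x)
            show ?case
            proof (cases "x \<in> ?D")
              case D: True
              have "x \<noteq> y"
                using True D r by auto
              then show ?thesis
                using elim far(2)[OF D] sep[OF D True] D by simp
            qed simp
          qed
        qed
        also have "\<dots> = (\<integral>\<^sup>+x\<in>?A. ennreal (norm (K x y - K x c')) \<partial>lebesgue)"
          by (rule nn_integral_completion[symmetric])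
        also have "\<dots> \<le> ennreal C"
          using C unfolding hormander_condition_def by blast
        finally show ?thesis
          by (rule mult_right_mono) simp
      qed simp
    qed
  qed
  also have "\<dots> = ennreal C * (\<integral>\<^sup>+y. ?w y \<partial>lborel)"
    by (rule nn_integral_cmult) measurable
  also have "(\<integral>\<^sup>+y. ?w y \<partial>lborel) = (\<integral>\<^sup>+y\<in>ball c r. ennreal (norm (f y)) \<partial>lborel)"
    by (intro nn_integral_cong_AE eventually_mono[OF fg]) simp
  also have "\<dots> = (\<integral>\<^sup>+y\<in>ball c r. ennreal (norm (f y)) \<partial>lebesgue)"
    by (rule nn_integral_completion[symmetric])
  finally show ?thesis .
qed

section \<open>Integrals controlled by the maximal function\<close>

lemma emeasure_lebesgue_ball:
  fixes c :: "'a::euclidean_space"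
  assumes "0 \<le> r"
  shows "emeasure lebesgue (ball c r) = ennreal (unit_ball_vol (DIM('a)) * r ^ DIM('a))"
  using emeasure_ball[OF assms, of c] by simp

text \<open>The maximal function is uncentred, so the mean over any ball containing z competes in
  the supremum at z; clear the volume, which is positive and finite.\<close>

lemma nn_integral_ball_le_hl_maximal:
  fixes f :: "real^'n \<Rightarrow> complex"
  assumes "z \<in> ball x r"
  shows "(\<integral>\<^sup>+y\<in>ball x r. ennreal (norm (f y)) \<partial>lebesgue) \<le>
    ennreal (unit_ball_vol CARD('n) * r ^ CARD('n)) * hl_maximal f z"
proof -
  let ?b = "emeasure lebesgue (ball x r)" and ?I = "\<integral>\<^sup>+y\<in>ball x r. ennreal (norm (f y)) \<partial>lebesgue"
  have r: "0 < r"
    using assms by (metis ball_eq_empty empty_iff not_le)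
  have b: "?b = ennreal (unit_ball_vol CARD('n) * r ^ CARD('n))"
    using r by (simp only: emeasure_lebesgue_ball[OF less_imp_le[OF r]] DIM_cart) simp
  have "?b \<noteq> 0"
    using r by (simp add: b zero_less_mult_iff ennreal_eq_0_iff not_le)
  then have "?I = ?I / ?b * ?b"
    by (simp add: b ennreal_divide_times mult_divide_eq_ennreal flip: ennreal_times_divide)
  also have "?I / ?b \<le> hl_maximal f z"
    unfolding hl_maximal_def using assms r by (intro SUP_upper2[of "(x, r)"]) auto
  finally show ?thesis
    by (simp add: b mult.commute mult_right_mono)
qed

lemma dyadic_scale_exists:
  fixes t :: real
  assumes "1 \<le> t"
  shows "\<exists>k. 2 ^ k \<le> t \<and> t < 2 ^ Suc k"
proof -
  define m where "m = (LEAST m. t < 2 ^ m)"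
  have m: "t < 2 ^ m"
    unfolding m_def by (rule LeastI_ex) (simp add: real_arch_pow)
  then have "m \<noteq> 0"
    using assms by (cases m) auto
  then obtain k where k: "m = Suc k"
    using not0_implies_Suc by blast
  then have "\<not> t < 2 ^ k"
    using not_less_Least[of k "\<lambda>m. t < 2 ^ m"] unfolding m_def by simp
  with m k show ?thesis
    by (intro exI[of _ k]) (simp add: not_less)
qed

text \<open>Split the region into the dyadic annuli \<open>2^k * R \<le> dist x y < 2^(k + 1) * R\<close>; the \<open>k\<close>-th one
  contributes a multiple of \<open>2 powr (- \<gamma> * k)\<close>.\<close>

lemma hl_maximal_tail_bound:
  fixes f :: "real^'n \<Rightarrow> complex"
  assumes f [measurable]: "f \<in> borel_measurable lebesgue" and "0 < \<gamma>" and z: "dist x z < R"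
  shows "(\<integral>\<^sup>+y\<in>{y. R \<le> dist x y}.
      ennreal (R powr \<gamma> / dist x y powr (real CARD('n) + \<gamma>) * norm (f y)) \<partial>lebesgue)
    \<le> ennreal (unit_ball_vol CARD('n) * 2 ^ CARD('n) / (1 - 2 powr - \<gamma>)) * hl_maximal f z"
proof -
  have R: "0 < R"
    using z zero_le_dist[of x z] by linarith
  define N where "N = CARD('n)"
  define q where "q = 2 powr - \<gamma>"
  \<comment> \<open>\<open>a k\<close> is the weight at the inner radius of the k-th annulus, hence
    its maximum there; \<open>B k\<close> is the ball of the outer radius.\<close>
  define a where "a k = R powr \<gamma> / (2 ^ k * R) powr (real N + \<gamma>)" for k :: nat
  define B where "B k = ball x (2 ^ Suc k * R)" for k :: nat
  define V where "V = unit_ball_vol (real N) * 2 ^ N"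
  have q: "0 < q" "q < 1"
    using \<open>0 < \<gamma>\<close> by (auto simp: q_def powr_less_one)
  have V: "0 \<le> V"
    by (simp add: V_def)
  have B [measurable]: "B k \<in> sets lebesgue" for k
    by (simp add: B_def)
  \<comment> \<open>The volume cancels the n-th power in the weight and the powers of R cancel,
    leaving the geometric factor \<open>q ^ k\<close>.\<close>
  have a_vol: "a k * (unit_ball_vol N * (2 ^ Suc k * R) ^ N) = V * q ^ k" for k
  proof -
    have "(2 ^ k * R) powr (real N + \<gamma>) = (2 ^ k * R) ^ N * ((2 powr \<gamma>) ^ k * R powr \<gamma>)"
      using R by (simp add: powr_add powr_mult powr_realpow powr_powr mult.commute
          flip: powr_realpow power_mult_distrib)
    moreover have "(2 ^ Suc k * R) ^ N = 2 ^ N * (2 ^ k * R) ^ N"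
      by (simp add: power_mult_distrib)
    moreover have "q ^ k = 1 / (2 powr \<gamma>) ^ k"
      by (simp add: q_def powr_minus power_inverse field_simps)
    ultimately show ?thesis
      using R by (simp add: a_def V_def field_simps)
  qed
  \<comment> \<open>Each y in the region lies in some annulus, and one term of the series already
    dominates; annuli are enlarged to the full balls \<open>B k\<close>.\<close>
  have "(\<integral>\<^sup>+y\<in>{y. R \<le> dist x y}.
      ennreal (R powr \<gamma> / dist x y powr (real CARD('n) + \<gamma>) * norm (f y)) \<partial>lebesgue)
    \<le> (\<integral>\<^sup>+y. (\<Sum>k. ennreal (a k) * (ennreal (norm (f y)) * indicator (B k) y)) \<partial>lebesgue)"
  proof (rule nn_integral_mono)
    fix y
    let ?t = "\<lambda>k. ennreal (a k) * (ennreal (norm (f y)) * indicator (B k) y)"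
    show "ennreal (R powr \<gamma> / dist x y powr (real CARD('n) + \<gamma>) * norm (f y)) *
        indicator {y. R \<le> dist x y} y \<le> suminf ?t"
    proof (cases "R \<le> dist x y")
      case True
      then obtain k where "2 ^ k \<le> dist x y / R" "dist x y / R < 2 ^ Suc k"
        using dyadic_scale_exists[of "dist x y / R"] R by auto
      then have k: "2 ^ k * R \<le> dist x y" "dist x y < 2 ^ Suc k * R"
        using R by (auto simp: field_simps)
      have "0 < 2 ^ k * R" "0 < dist x y"
        using True R by (auto intro: less_le_trans)
      then have "R powr \<gamma> / dist x y powr (real CARD('n) + \<gamma>) \<le> a k"
        unfolding a_def N_def using k(1) \<open>0 < \<gamma>\<close>
        by (intro divide_left_mono powr_mono2 mult_pos_pos) auto
      then have "ennreal (R powr \<gamma> / dist x y powr (real CARD('n) + \<gamma>) * norm (f y)) \<le>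
          ennreal (a k * norm (f y))"
        by (intro ennreal_leI mult_right_mono) auto
      also have "\<dots> = ?t k"
        using k(2) by (subst ennreal_mult') (auto simp: B_def a_def)
      also have "\<dots> \<le> suminf ?t"
        using sum_le_suminf[of ?t "{k}"] by simp
      finally show ?thesis
        using True by simp
    qed simp
  qed
  also have "\<dots> = (\<Sum>k. \<integral>\<^sup>+y. ennreal (a k) * (ennreal (norm (f y)) * indicator (B k) y) \<partial>lebesgue)"
    by (rule nn_integral_suminf) measurable
  also have "\<dots> = (\<Sum>k. ennreal (a k) * (\<integral>\<^sup>+y\<in>B k. ennreal (norm (f y)) \<partial>lebesgue))"
    by (intro suminf_cong nn_integral_cmult) measurable
  also have "\<dots> \<le> (\<Sum>k. ennreal (V * q ^ k) * hl_maximal f z)"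
  proof (intro suminf_le summableI)
    fix k
    have "z \<in> B k"
    proof -
      have "1 * R \<le> 2 ^ Suc k * R"
        using R by (intro mult_right_mono) (auto intro: one_le_power simp del: power_Suc)
      with z show ?thesis
        by (simp add: B_def)
    qed
    then have "ennreal (a k) * (\<integral>\<^sup>+y\<in>B k. ennreal (norm (f y)) \<partial>lebesgue) \<le>
        ennreal (a k) * (ennreal (unit_ball_vol N * (2 ^ Suc k * R) ^ N) * hl_maximal f z)"
      unfolding B_def N_def by (intro mult_left_mono nn_integral_ball_le_hl_maximal) auto
    also have "\<dots> = ennreal (a k * (unit_ball_vol N * (2 ^ Suc k * R) ^ N)) * hl_maximal f z"
      by (subst ennreal_mult') (auto simp: a_def mult.assoc)
    finally show "ennreal (a k) * (\<integral>\<^sup>+y\<in>B k. ennreal (norm (f y)) \<partial>lebesgue) \<le>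
        ennreal (V * q ^ k) * hl_maximal f z"
      by (simp only: a_vol)
  qed
  also have "\<dots> = (\<Sum>k. ennreal (V * q ^ k)) * hl_maximal f z"
    by simp
  also have "(\<Sum>k. ennreal (V * q ^ k)) = ennreal (V * (1 / (1 - q)))"
    using q V by (intro suminf_ennreal_eq sums_mult geometric_sums) auto
  finally show ?thesis
    by (simp add: V_def N_def q_def)
qed

section \<open>The Hoelder estimate\<close>

text \<open>Where f does not vanish, |x - y| > 3r > 2|x - x'|, so the Hoelder condition applies
  throughout the integral of the kernel difference. The constant uses |C| because C may have any
  sign.\<close>

lemma holder_oscillation_bound:
  fixes T :: "(real^'n \<Rightarrow> complex) \<Rightarrow> (real^'n \<Rightarrow> complex)"
  assumes T: "singular_integral_operator T K" and C: "holder_condition K C \<gamma>" and "0 < \<gamma>"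
    and f: "f \<in> Linf_c" and supp: "\<forall>x\<in>ball c (4 * r). f x = 0"
    and x: "x \<in> ball c r" and x': "x' \<in> ball x r" and z: "z \<in> ball c r"
  shows "ennreal (norm (T f x)) \<le> ennreal (norm (T f x')) +
    ennreal (\<bar>C\<bar> * (unit_ball_vol CARD('n) * 2 ^ CARD('n) / (1 - 2 powr - \<gamma>))) * hl_maximal f z"
proof -
  have r: "0 < r"
    using x zero_le_dist[of c x] by (simp only: mem_ball)
  have f_meas: "f \<in> borel_measurable lebesgue"
    using f by (simp add: Linf_c_def)
  have "fun_supp f \<subseteq> - ball c (4 * r)"
    using supp by (intro fun_supp_subset_closed) auto
  moreover have "dist c x' < 4 * r" "dist c x < 4 * r"
    using x x' r dist_triangle[of c x' x] by auto
  ultimately have "x \<notin> fun_supp f" "x' \<notin> fun_supp f"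
    by auto
  note rep = singular_integral_operator_eq[OF T f this(1)] singular_integral_operator_eq[OF T f this(2)]
  have diff: "T f x - T f x' = (\<integral>y. K x y * f y - K x' y * f y \<partial>lebesgue)"
    unfolding rep(2) rep(4) by (rule Bochner_Integration.integral_diff[OF rep(1) rep(3), symmetric])
  \<comment> \<open>The tail bound is used with R = 2r: this exceeds |x - z| for all x, z in B, yet
    stays below the distance 3r to the support. The numerator |x - x'|^\<gamma> is enlarged to
    match.\<close>
  let ?w = "\<lambda>y. ennreal ((2 * r) powr \<gamma> / dist x y powr (real CARD('n) + \<gamma>) * norm (f y)) *
    indicator {y. 2 * r \<le> dist x y} y"
  have w: "?w \<in> borel_measurable lebesgue"
  proof -
    have "(\<lambda>y. (2 * r) powr \<gamma> / dist x y powr (real CARD('n) + \<gamma>)) \<in> borel_measurable lebesgue"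
      by (intro measurable_completion) measurable
    moreover have "{y. 2 * r \<le> dist x y} \<in> sets lebesgue"
      by (intro sets_completionI_sets) simp
    ultimately show ?thesis
      using f_meas by measurable
  qed
  have "ennreal (norm (T f x)) \<le> ennreal (norm (T f x')) + ennreal (norm (T f x - T f x'))"
    using norm_triangle_sub[of "T f x" "T f x'"] by (simp flip: ennreal_plus add: ennreal_leI)
  also have "ennreal (norm (T f x - T f x')) \<le>
      (\<integral>\<^sup>+y. norm (K x y * f y - K x' y * f y) \<partial>lebesgue)"
    unfolding diff by (intro integral_norm_bound_ennreal Bochner_Integration.integrable_diff rep)
  also have "\<dots> \<le> (\<integral>\<^sup>+y. ennreal \<bar>C\<bar> * ?w y \<partial>lebesgue)"
  proof (rule nn_integral_mono)
    fix y
    show "ennreal (norm (K x y * f y - K x' y * f y)) \<le> ennreal \<bar>C\<bar> * ?w y"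
    proof (cases "f y = 0")
      case False
      then have "4 * r \<le> dist c y"
        using supp by (auto simp: not_less)
      then have far: "3 * r < dist x y"
        using x dist_triangle[of c y x] by auto
      have xx': "dist x x' < r"
        using x' by simp
      have "norm (K x y - K x' y) \<le>
          C * (norm (x - x') powr \<gamma> / norm (x - y) powr (real CARD('n) + \<gamma>))"
        using C far xx' r unfolding holder_condition_def dist_norm by auto
      also have "\<dots> \<le> \<bar>C\<bar> * ((2 * r) powr \<gamma> / dist x y powr (real CARD('n) + \<gamma>))"
        using xx' r \<open>0 < \<gamma>\<close> unfolding dist_norm
        by (intro mult_mono divide_right_mono powr_mono2) auto
      finally have "norm (K x y - K x' y) * norm (f y) \<le>
          \<bar>C\<bar> * ((2 * r) powr \<gamma> / dist x y powr (real CARD('n) + \<gamma>)) * norm (f y)"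
        by (rule mult_right_mono) simp
      then have "ennreal (norm (K x y * f y - K x' y * f y)) \<le> ennreal
          (\<bar>C\<bar> * ((2 * r) powr \<gamma> / dist x y powr (real CARD('n) + \<gamma>) * norm (f y)))"
        by (intro ennreal_leI) (simp add: norm_mult mult.assoc flip: left_diff_distrib)
      also have "\<dots> = ennreal \<bar>C\<bar> * ?w y"
        using far r by (subst ennreal_mult') auto
      finally show ?thesis .
    qed simp
  qed
  also have "\<dots> = ennreal \<bar>C\<bar> * (\<integral>\<^sup>+y. ?w y \<partial>lebesgue)"
    by (rule nn_integral_cmult[OF w])
  also have "\<dots> \<le> ennreal \<bar>C\<bar> *
      (ennreal (unit_ball_vol CARD('n) * 2 ^ CARD('n) / (1 - 2 powr - \<gamma>)) * hl_maximal f z)"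
  proof (intro mult_left_mono hl_maximal_tail_bound f_meas \<open>0 < \<gamma>\<close>)
    show "dist x z < 2 * r"
      using x z dist_triangle[of x z c] by (simp add: dist_commute)
  qed simp
  also have "\<dots> = ennreal
      (\<bar>C\<bar> * (unit_ball_vol CARD('n) * 2 ^ CARD('n) / (1 - 2 powr - \<gamma>))) * hl_maximal f z"
    by (subst ennreal_mult'[of "\<bar>C\<bar>"]) (simp_all add: mult.assoc)
  finally show ?thesis
    by (simp add: add_left_mono)
qed

text \<open>Solve each inequality for \<open>M z\<close>, take the infimum, and undo. Finiteness of
  a avoids subtracting \<open>top\<close> from \<open>top\<close>, and A > 0 permits the
  division.\<close>

lemma le_add_mult_INF_ennreal:
  fixes a p :: ennreal
  assumes "a < top" "0 < A" "\<And>z. z \<in> S \<Longrightarrow> a \<le> p + ennreal A * M z"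
  shows "a \<le> p + ennreal A * (INF z\<in>S. M z)"
proof -
  have "(a - p) / ennreal A \<le> (INF z\<in>S. M z)"
    using assms by (intro INF_greatest divide_le_posI_ennreal) (auto simp: ennreal_minus_le_iff)
  then have "ennreal A * ((a - p) / ennreal A) \<le> ennreal A * (INF z\<in>S. M z)"
    by (rule mult_left_mono) simp
  moreover have "ennreal A * ((a - p) / ennreal A) = a - p"
    using \<open>0 < A\<close> mult_divide_eq_ennreal[of "ennreal A" "a - p"]
    by (simp add: ennreal_times_divide mult.commute)
  ultimately show ?thesis
    using assms(1) by (simp add: ennreal_minus_le_iff)
qed

text \<open>Averaging the oscillation bound over \<open>ball x r\<close>, which lies in \<open>ball c (2 * r)\<close>, rather than over
  \<open>ball c (2 * r)\<close> itself keeps \<open>x'\<close> close enough to \<open>x\<close> for the Hoelder condition: the support of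
  \<open>f\<close> is more than \<open>3 * r\<close> away from \<open>x\<close>.\<close>

lemma holder_sup_bound:
  fixes T :: "(real^'n \<Rightarrow> complex) \<Rightarrow> (real^'n \<Rightarrow> complex)"
  assumes T: "singular_integral_operator T K" and C: "holder_condition K C \<gamma>" and "0 < \<gamma>"
    and r: "0 < r" and f: "f \<in> Linf_c" and supp: "\<forall>x\<in>ball c (4 * r). f x = 0"
    and x: "x \<in> ball c r"
    and A: "\<bar>C\<bar> * (unit_ball_vol CARD('n) * 2 ^ CARD('n) / (1 - 2 powr - \<gamma>)) \<le> A" "0 < A"
  shows "ennreal (norm (T f x)) \<le>
    ennreal (2 ^ CARD('n)) / emeasure lebesgue (ball c (2 * r)) *
      (\<integral>\<^sup>+x\<in>ball c (2 * r). ennreal (norm (T f x)) \<partial>lebesgue)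
    + ennreal A * (INF x\<in>ball c r. hl_maximal f x)"
proof (rule le_add_mult_INF_ennreal)
  fix z assume z: "z \<in> ball c r"
  define D where "D = ennreal A * hl_maximal f z"
  define v where "v = unit_ball_vol CARD('n) * r ^ CARD('n)"
  let ?J = "\<integral>\<^sup>+x\<in>ball c (2 * r). ennreal (norm (T f x)) \<partial>lebesgue"
  have v: "0 < v"
    using r by (simp add: v_def)
  have b: "emeasure lebesgue (ball x r) = ennreal v"
    using r by (simp only: emeasure_lebesgue_ball less_imp_le DIM_cart) (simp add: v_def)
  have b2: "emeasure lebesgue (ball c (2 * r)) = ennreal (2 ^ CARD('n) * v)"
    using r emeasure_lebesgue_ball[of "2 * r" c]
    by (simp add: v_def power_mult_distrib mult.left_commute)
  have meas: "(\<lambda>y. ennreal (norm (T f y))) \<in> borel_measurable lebesgue"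
    using T f by (auto simp: singular_integral_operator_def)
  \<comment> \<open>Integrate the constant |T f x| over \<open>ball x r\<close> and apply the
    oscillation bound with the integration variable as x'.\<close>
  have "ennreal (norm (T f x)) * ennreal v = (\<integral>\<^sup>+y\<in>ball x r. ennreal (norm (T f x)) \<partial>lebesgue)"
    using b by (simp add: nn_integral_cmult_indicator)
  also have "\<dots> \<le> (\<integral>\<^sup>+y. ennreal (norm (T f y)) * indicator (ball x r) y + D * indicator (ball x r) y \<partial>lebesgue)"
  proof (rule nn_integral_mono)
    fix y
    show "ennreal (norm (T f x)) * indicator (ball x r) y
        \<le> ennreal (norm (T f y)) * indicator (ball x r) y + D * indicator (ball x r) y"
    proof (cases "y \<in> ball x r")
      case True
      have "ennreal (norm (T f x)) \<le> ennreal (norm (T f y)) +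
        ennreal (\<bar>C\<bar> * (unit_ball_vol CARD('n) * 2 ^ CARD('n) / (1 - 2 powr - \<gamma>))) * hl_maximal f z"
        by (rule holder_oscillation_bound[OF T C \<open>0 < \<gamma>\<close> f supp x True z])
      also have "\<dots> \<le> ennreal (norm (T f y)) + D"
        unfolding D_def by (intro add_left_mono mult_right_mono ennreal_leI A) simp
      finally show ?thesis
        using True by simp
    qed simp
  qed
  also have "\<dots> = (\<integral>\<^sup>+y\<in>ball x r. ennreal (norm (T f y)) \<partial>lebesgue) + D * ennreal v"
    using b
    by (subst nn_integral_add; (intro borel_measurable_times_ennreal borel_measurable_indicator meas)?)
      (simp_all add: nn_integral_cmult_indicator)
  also have "\<dots> \<le> ?J + D * ennreal v"
  proof (intro add_right_mono nn_integral_mono mult_left_mono)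
    fix y
    show "indicator (ball x r) y \<le> (indicator (ball c (2 * r)) y :: ennreal)"
      using x dist_triangle[of c y x] by (auto simp: indicator_def)
  qed simp
  finally have "ennreal (norm (T f x)) * ennreal v / ennreal v \<le> (?J + D * ennreal v) / ennreal v"
    by (rule divide_right_mono_ennreal)
  then have "ennreal (norm (T f x)) \<le> ?J / ennreal v + D"
    using v by (simp add: mult_divide_eq_ennreal add_divide_distrib_ennreal)
  also have "?J / ennreal v = ennreal (1 / v) * ?J"
    using v by (simp add: divide_ennreal_def inverse_ennreal mult.commute flip: inverse_eq_divide)
  \<comment> \<open>\<open>ball x r\<close> has the volume of B, so passing to the mean over 2B
    costs the factor 2^n.\<close>
  also have "ennreal (1 / v) = ennreal (2 ^ CARD('n)) / emeasure lebesgue (ball c (2 * r))"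
    using v unfolding b2 by (simp add: divide_ennreal)
  finally show "ennreal (norm (T f x)) \<le>
      ennreal (2 ^ CARD('n)) / emeasure lebesgue (ball c (2 * r)) * ?J
      + ennreal A * hl_maximal f z"
    unfolding D_def .
qed (use A in auto)

section \<open>Choice of the constants\<close>

theorem proposition3p6:
  fixes T :: "(real^'n \<Rightarrow> complex) \<Rightarrow> (real^'n \<Rightarrow> complex)"
    and K :: "real^'n \<Rightarrow> real^'n \<Rightarrow> complex"
  assumes "singular_integral_operator T K"
  shows
    "((\<exists>C. hormander_condition K C) \<longrightarrow>
       (\<exists>C'::real. \<forall>c r f. 0 < r \<longrightarrow> f \<in> Linf_c \<longrightarrow> (\<forall>x. x \<notin> ball c r \<longrightarrow> f x = 0) \<longrightarrow>
          (LINT x:ball c r|lebesgue. f x) = 0 \<longrightarrow>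
          (\<integral>\<^sup>+x\<in>- ball c (4 * r). ennreal (norm (T f x)) \<partial>lebesgue)
            \<le> ennreal C' * (\<integral>\<^sup>+x\<in>ball c r. ennreal (norm (f x)) \<partial>lebesgue)))
     \<and>
     ((\<exists>C \<gamma>. 0 < \<gamma> \<and> holder_condition K C \<gamma>) \<longrightarrow>
       (\<exists>C'::real. \<forall>c r f. 0 < r \<longrightarrow> f \<in> Linf_c \<longrightarrow> (\<forall>x\<in>ball c (4 * r). f x = 0) \<longrightarrow>
          (SUP x\<in>ball c r. ennreal (norm (T f x)))
            \<le> ennreal C' / emeasure lebesgue (ball c (2 * r)) *
                (\<integral>\<^sup>+x\<in>ball c (2 * r). ennreal (norm (T f x)) \<partial>lebesgue)
              + ennreal C' * (INF x\<in>ball c r. hl_maximal f x)))"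
proof (intro conjI impI; elim exE conjE)
  fix C
  assume "hormander_condition K C"
  then show "\<exists>C'::real. \<forall>c r f. 0 < r \<longrightarrow> f \<in> Linf_c \<longrightarrow> (\<forall>x. x \<notin> ball c r \<longrightarrow> f x = 0) \<longrightarrow>
      (LINT x:ball c r|lebesgue. f x) = 0 \<longrightarrow>
      (\<integral>\<^sup>+x\<in>- ball c (4 * r). ennreal (norm (T f x)) \<partial>lebesgue)
        \<le> ennreal C' * (\<integral>\<^sup>+x\<in>ball c r. ennreal (norm (f x)) \<partial>lebesgue)"
    by (intro exI[of _ C] allI impI, rule hormander_mean_zero_bound[OF assms])
next
  fix C \<gamma> :: real
  assume \<gamma>: "0 < \<gamma>" and C: "holder_condition K C \<gamma>"
  \<comment> \<open>The summand 1 keeps A positive even when C = 0, as the passage to the infimum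
    requires.\<close>
  define A where "A = 1 + \<bar>C\<bar> * (unit_ball_vol CARD('n) * 2 ^ CARD('n) / (1 - 2 powr - \<gamma>))"
  have "2 powr - \<gamma> < 1"
    using \<gamma> by (simp add: powr_less_one)
  then have A: "\<bar>C\<bar> * (unit_ball_vol CARD('n) * 2 ^ CARD('n) / (1 - 2 powr - \<gamma>)) \<le> A" "0 < A"
    by (auto simp: A_def intro!: add_pos_nonneg)
  show "\<exists>C'::real. \<forall>c r f. 0 < r \<longrightarrow> f \<in> Linf_c \<longrightarrow> (\<forall>x\<in>ball c (4 * r). f x = 0) \<longrightarrow>
      (SUP x\<in>ball c r. ennreal (norm (T f x)))
        \<le> ennreal C' / emeasure lebesgue (ball c (2 * r)) *
            (\<integral>\<^sup>+x\<in>ball c (2 * r). ennreal (norm (T f x)) \<partial>lebesgue)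
          + ennreal C' * (INF x\<in>ball c r. hl_maximal f x)"
  \<comment> \<open>One constant that dominates both the factor 2^n of the mean and the factor A of
    the maximal function.\<close>
  proof (intro exI[of _ "2 ^ CARD('n) + A"] allI impI SUP_least)
    fix c x :: "real^'n" and r f
    assume *: "0 < r" "f \<in> Linf_c" "\<forall>x\<in>ball c (4 * r). f x = 0" "x \<in> ball c r"
    show "ennreal (norm (T f x)) \<le>
      ennreal (2 ^ CARD('n) + A) / emeasure lebesgue (ball c (2 * r)) *
        (\<integral>\<^sup>+x\<in>ball c (2 * r). ennreal (norm (T f x)) \<partial>lebesgue)
      + ennreal (2 ^ CARD('n) + A) * (INF x\<in>ball c r. hl_maximal f x)"
      using A(2)
      by (intro order_trans[OF holder_sup_bound[OF assms C \<gamma> * A]] add_mono mult_right_mono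
          divide_right_mono_ennreal ennreal_leI) auto
  qed
qed

end
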